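(* Let $\{p(\tau)\}_{\tau\in\mathbb{N}_0}$ be a probability distribution on $\mathbb{N}_0$, let $T$ be a random variable with $\mathbb{P}(T=\tau)=p(\tau)$ for $\tau\in\mathbb{N}_0$, and let $\{(X,T)_t\}_{t\ge 0}$ be the trapped random walk with trapping time distribution $p$, started at the origin, i.e. $\mathbb{P}((X,T)_0=(z,\tau))=p(\tau)$ if $z=0$ and $=0$ otherwise. Let $\mathbb{E}(T)<\infty$ and define $\mu:=\mathbb{E}(T)+1$. If in addition $\lim_{\tau\to\infty}\mathbb{P}(T\geq s\,\tau)/\mathbb{P}(T\geq\tau)=s^{-1}$ for each real $s>0$, then for each bounded interval $I\subset\mathbb{R}$, $$\lim_{t\to\infty}\left|\mathbb{P}\left(X_t\in\sqrt{\frac{t}{\mu}}\,I\right)-\frac{1}{\sqrt{2\pi}}\int_I e^{-x^2/2}\,dx\right|=0.$$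
   Context: $\mathbb{N}_0=\{0,1,2,\dots\}$; for $c>0$ and $I\subset\mathbb{R}$, $c\,I=\{cx: x\in I\}$. Trapped random walk with trapping time distribution $p$: the discrete-time Markov chain $(X,T)_t=(X_t,T_t)$ on $\mathbb{Z}\times\mathbb{N}_0$ with transition probabilities $$\mathbb{P}((X,T)_{t+1}=(z',\tau')\mid (X,T)_t=(z,\tau))=\begin{cases}p(\tau')/2 & \text{if } |z-z'|=1 \text{ and } \tau=0,\\ 1 & \text{if } z=z' \text{ and } \tau'=\tau-1\geq 0,\\ 0&\text{otherwise.}\end{cases}$$ $X_t$ is the position and $T_t$ the remaining trapping time; $T$ without subscript denotes a generic trapping time with law $p$. *)

theory Defs
  imports "HOL-Probability.Probability"
begin

text \<open>
  Time-homogeneous discrete-time Markov chains on a countable state space, given as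
  processes on an arbitrary probability space. The Markov property is imposed only for
  histories of positive probability, since \<^const>\<open>cond_prob\<close> is a quotient
  with the convention \<open>x / 0 = 0\<close>.
\<close>

locale markov_chain = prob_space M
  for M :: "'a measure" and P :: "'s::countable \<Rightarrow> 's \<Rightarrow> real" and Y :: "nat \<Rightarrow> 'a \<Rightarrow> 's" +
  assumes measurable_state: "\<And>t. Y t \<in> measurable M (count_space UNIV)"
    and transition: "\<And>t (y :: nat \<Rightarrow> 's) y'.
      \<P>(\<omega> in M. \<forall>i\<le>t. Y i \<omega> = y i) > 0 \<Longrightarrow>
      \<P>(\<omega> in M. Y (Suc t) \<omega> = y' \<bar> \<forall>i\<le>t. Y i \<omega> = y i) = P (y t) y'"

definition trapped_step :: "nat pmf \<Rightarrow> int \<times> nat \<Rightarrow> int \<times> nat \<Rightarrow> real" where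
  "trapped_step p = (\<lambda>(z, \<tau>) (z', \<tau>').
     if \<bar>z - z'\<bar> = 1 \<and> \<tau> = 0 then pmf p \<tau>' / 2
     else if z = z' \<and> \<tau> = Suc \<tau>' then 1
     else 0)"

definition trapped_random_walk :: "'a measure \<Rightarrow> nat pmf \<Rightarrow> (nat \<Rightarrow> 'a \<Rightarrow> int \<times> nat) \<Rightarrow> bool" where
  "trapped_random_walk M p XT \<longleftrightarrow> markov_chain M (trapped_step p) XT"

end

theory Submission
  imports Defs "HOL-Real_Asymp.Real_Asymp"
begin

text \<open>
  Put \<open>a = cos \<theta>\<close>, \<open>F k = P(T \<ge> k)\<close>, \<open>\<phi> t = E cos (\<theta> X\<^sub>t)\<close> and
  \<open>w t = E (cos (\<theta> X\<^sub>t); T\<^sub>t = 0)\<close>. One step of the chain gives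
  \<open>\<phi> (t + 1) = \<phi> t - (1 - a) w t\<close>, and unrolling the trapping time gives the renewal equation
  \<open>\<phi> t = F t + a \<Sum>\<^bsub>s<t\<^esub> w s F (t - s - 1)\<close>. Together they imply
  \<open>(1 - a) \<Sum>\<^bsub>k\<le>t\<^esub> \<phi> k = \<Sum>\<^bsub>k\<le>t\<^esub> F k - a \<Sum>\<^bsub>k\<le>t\<^esub> F k \<phi> (t - k)\<close>.
  Since \<open>\<phi>\<close> moves by at most \<open>1 - a\<close> per step and \<open>\<Sum>F = \<mu>\<close>, the last sum is close to
  \<open>\<mu> \<phi> t\<close>. With \<open>\<delta> = (1 - a) / a\<close>, this makes \<open>\<phi>\<close> an approximate solution of
  \<open>\<mu> x t + \<delta> \<Sum>\<^bsub>k\<le>t\<^esub> x k = \<mu>\<close>, whose exact solution is \<open>(1 + \<delta> / \<mu>)\<close> to the power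
  \<open>-(t + 1)\<close>. At \<open>\<theta> = u / sqrt (t / \<mu>)\<close> this power tends to \<open>exp (- u\<^sup>2 / 2)\<close>, while
  the error is controlled by Cesaro means of the tails of \<open>\<Sum>F\<close>. As \<open>E sin (\<theta> X\<^sub>t) = 0\<close>,
  Levy's continuity theorem applies.
\<close>

section \<open>Renewal equations\<close>

lemma Cesaro_mean_null:
  fixes r :: "nat \<Rightarrow> real"
  assumes "r \<longlonglongrightarrow> 0"
  shows "(\<lambda>n. (\<Sum>k\<le>n. r k) / real (Suc n)) \<longlonglongrightarrow> 0"
proof (rule LIMSEQ_I)
  fix e :: real assume e: "e > 0"
  obtain m where m: "\<And>k. k \<ge> m \<Longrightarrow> \<bar>r k\<bar> < e / 2"
    using LIMSEQ_D[OF assms, of "e / 2"] e by auto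
  have "(\<lambda>n. (\<Sum>k<m. \<bar>r k\<bar>) / real (Suc n)) \<longlonglongrightarrow> 0"
    by (intro tendsto_divide_0[OF tendsto_const] filterlim_compose[OF filterlim_real_at_infinity_sequentially filterlim_Suc])
  from LIMSEQ_D[OF this, of "e / 2"] e obtain n0 where
    n0: "\<And>n. n \<ge> n0 \<Longrightarrow> (\<Sum>k<m. \<bar>r k\<bar>) / real (Suc n) < e / 2"
    by (fastforce simp: abs_if sum_nonneg split: if_splits)
  show "\<exists>n0. \<forall>n\<ge>n0. norm ((\<Sum>k\<le>n. r k) / real (Suc n) - 0) < e"
  proof (intro exI allI impI)
    fix n assume n: "n \<ge> max n0 m"
    have "\<bar>\<Sum>k\<le>n. r k\<bar> \<le> (\<Sum>k\<le>n. \<bar>r k\<bar>)" by (rule sum_abs)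
    also have "\<dots> = (\<Sum>k<m. \<bar>r k\<bar>) + (\<Sum>k=m..n. \<bar>r k\<bar>)"
      using n by (subst sum.union_disjoint[symmetric]) (auto intro!: sum.cong)
    also have "(\<Sum>k=m..n. \<bar>r k\<bar>) \<le> (\<Sum>k=m..n. e / 2)"
      using m by (intro sum_mono) (auto intro: less_imp_le)
    also have "\<dots> \<le> (e / 2) * real (Suc n)"
      using e by (auto intro!: mult_left_mono simp: mult.commute)
    finally have "\<bar>\<Sum>k\<le>n. r k\<bar> \<le> (\<Sum>k<m. \<bar>r k\<bar>) + (e / 2) * real (Suc n)" by (simp add: mult.commute)
    from divide_right_mono[OF this, of "real (Suc n)"]
    have "\<bar>\<Sum>k\<le>n. r k\<bar> / real (Suc n) \<le> (\<Sum>k<m. \<bar>r k\<bar>) / real (Suc n) + e / 2"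
      by (simp only: add_divide_distrib nonzero_mult_div_cancel_right of_nat_eq_0_iff nat.simps not_False_eq_True)
    moreover have "(\<Sum>k<m. \<bar>r k\<bar>) / real (Suc n) < e / 2" using n n0[of n] by simp
    ultimately show "norm ((\<Sum>k\<le>n. r k) / real (Suc n) - 0) < e"
      by (simp only: diff_zero real_norm_def abs_divide abs_of_nat)
  qed
qed

text \<open>Summation by parts, since \<open>r (Suc t) = r t - F (Suc t)\<close>. When
  \<open>\<mu>\<close> is the sum of the series, \<open>r\<close> is a null sequence, so the
  truncated moment of \<open>F\<close>, which may grow without bound, is controlled by partial sums
  of \<open>r\<close> and is of order o(t).\<close>

lemma sum_weighted_tail_eq:
  fixes F :: "nat \<Rightarrow> real" and \<mu> :: real
  defines "r \<equiv> \<lambda>s. \<mu> - (\<Sum>k\<le>s. F k)"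
  shows "(\<Sum>k\<le>t. real k * F k) + real t * r t = (\<Sum>s<t. r s)"
proof (induction t)
  case (Suc t)
  have "r (Suc t) = r t - F (Suc t)" by (simp add: r_def)
  then have "real (Suc t) * F (Suc t) + real (Suc t) * r (Suc t) = r t + real t * r t"
    by (simp flip: distrib_left add: distrib_right)
  with Suc show ?case by simp
qed simp

lemma abs_diff_le_Lipschitz:
  fixes \<phi> :: "nat \<Rightarrow> real"
  assumes "\<And>n. \<bar>\<phi> (Suc n) - \<phi> n\<bar> \<le> c"
  shows "\<bar>\<phi> (n + k) - \<phi> n\<bar> \<le> real k * c"
proof (induction k)
  case (Suc k)
  then show ?case using assms[of "n + k"] by (simp add: algebra_simps)
qed simp

text \<open>Convolving the step relation with \<open>F\<close> expresses the increment of the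
  convolution of \<open>F\<close> and \<open>\<phi>\<close> through that of \<open>F\<close> and
  \<open>w\<close>; the renewal equation then replaces the latter by
  \<open>\<phi> (Suc t) - F (Suc t)\<close>. This eliminates \<open>w\<close>. The new boundary term
  is \<open>F (Suc t) * \<phi> 0\<close>.\<close>

lemma renewal_average_identity:
  fixes F \<phi> w :: "nat \<Rightarrow> real"
  assumes "\<phi> 0 = 1" "F 0 = 1"
    and step: "\<And>t. \<phi> (Suc t) = \<phi> t - (1 - a) * w t"
    and renewal: "\<And>t. \<phi> (Suc t) = F (Suc t) + a * (\<Sum>k\<le>t. F k * w (t - k))"
  shows "(1 - a) * (\<Sum>k\<le>t. \<phi> k) = (\<Sum>k\<le>t. F k) - a * (\<Sum>k\<le>t. F k * \<phi> (t - k))"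
proof (induction t)
  case (Suc t)
  have "(\<Sum>k\<le>t. F k * \<phi> (Suc t - k)) = (\<Sum>k\<le>t. F k * \<phi> (t - k)) - (1 - a) * (\<Sum>k\<le>t. F k * w (t - k))"
    unfolding sum_distrib_left sum_subtractf[symmetric]
    by (intro sum.cong) (auto simp: Suc_diff_le step algebra_simps)
  then have "a * (\<Sum>k\<le>t. F k * \<phi> (Suc t - k)) =
      a * (\<Sum>k\<le>t. F k * \<phi> (t - k)) - (1 - a) * (a * (\<Sum>k\<le>t. F k * w (t - k)))"
    by (simp add: right_diff_distrib mult.left_commute)
  also have "a * (\<Sum>k\<le>t. F k * w (t - k)) = \<phi> (Suc t) - F (Suc t)"
    by (simp add: renewal)
  finally have "a * (\<Sum>k\<le>t. F k * \<phi> (Suc t - k)) =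
      a * (\<Sum>k\<le>t. F k * \<phi> (t - k)) - (1 - a) * (\<phi> (Suc t) - F (Suc t))"
    by (simp add: algebra_simps)
  with Suc assms show ?case by (simp add: algebra_simps)
qed (use assms in simp)

text \<open>\<open>E\<close> is the defect of \<open>\<phi>\<close> in the equation that the
  geometric sequence \<open>g\<close> solves exactly, and \<open>D\<close> sums the differences
  \<open>\<phi> k - g k\<close>. Then
  \<open>\<mu> * (\<phi> t - g t) = E t - \<delta> * D t\<close>; in the bound the first summand
  estimates \<open>\<delta> * \<bar>D t\<bar>\<close> and the second
  \<open>\<bar>E t\<bar>\<close>.\<close>

lemma renewal_geometric_bound:
  fixes F \<phi> :: "nat \<Rightarrow> real" and a \<mu> :: real
  defines "\<delta> \<equiv> (1 - a) / a"
    and "r \<equiv> \<lambda>s. \<mu> - (\<Sum>k\<le>s. F k)"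
  assumes F: "\<And>k. F k \<ge> 0" "F sums \<mu>" "\<mu> > 0"
    and a: "0 < a" "a \<le> 1"
    and \<phi>: "\<And>k. \<bar>\<phi> k\<bar> \<le> 1" "\<And>k. \<bar>\<phi> (Suc k) - \<phi> k\<bar> \<le> 1 - a"
    and average: "\<And>t. (1 - a) * (\<Sum>k\<le>t. \<phi> k) = (\<Sum>k\<le>t. F k) - a * (\<Sum>k\<le>t. F k * \<phi> (t - k))"
  defines "R \<equiv> \<lambda>t. \<Sum>s\<le>t. r s"
  shows "\<bar>\<phi> t - 1 / (1 + \<delta> / \<mu>) ^ Suc t\<bar> \<le>
    (\<delta> / \<mu> * (real (Suc t) * (\<delta> * (\<mu> + R t)) + 2 * R t) + (\<delta> * (\<mu> + R t) + 2 * r t)) / \<mu>"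
proof -
  define S where "S = (\<lambda>s. \<Sum>k\<le>s. F k)"
  define G where "G = (\<lambda>s. \<Sum>k\<le>s. F k * \<phi> (s - k))"
  define E where "E = (\<lambda>s. \<mu> * \<phi> s + \<delta> * (\<Sum>k\<le>s. \<phi> k) - \<mu>)"
  define g where "g = (\<lambda>s. 1 / (1 + \<delta> / \<mu>) ^ Suc s)"
  define D where "D = (\<lambda>s. \<Sum>k\<le>s. \<phi> k - g k)"
  have \<delta>0: "\<delta> \<ge> 0" using a by (simp add: \<delta>_def)
  have a\<delta>: "1 - a \<le> \<delta>"
    using a mult_left_mono[of a 1 "1 - a"] by (simp add: \<delta>_def pos_le_divide_eq)
  have r0: "r s \<ge> 0" for s
    using sum_le_suminf[of F "{..s}"] F(1,2) by (auto simp: r_def sums_iff)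
  have r_sum: "(\<Sum>k\<le>s. real k * F k) \<le> R t" if "s \<le> t" for s
  proof -
    have "(\<Sum>k\<le>s. real k * F k) \<le> (\<Sum>k<s. r k)"
      using sum_weighted_tail_eq[of F s \<mu>] r0[of s] mult_nonneg_nonneg[of "real s" "r s"]
      unfolding r_def by linarith
    also have "\<dots> \<le> R t" unfolding R_def using that r0 by (intro sum_mono2) auto
    finally show ?thesis .
  qed
  \<comment> \<open>Three sources of defect: replacing \<open>\<phi> (s - k)\<close> by
    \<open>\<phi> s\<close> in the convolution costs at most \<open>\<delta> * R t\<close> by the
    Lipschitz bound; dividing the averaged identity by \<open>a\<close>, with
    \<open>1 / a = 1 + \<delta>\<close>, costs \<open>\<delta> * \<mu>\<close>; replacing
    \<open>S s\<close> by \<open>\<mu>\<close> costs \<open>r s\<close> twice.\<close>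
  have E_bound: "\<bar>E s\<bar> \<le> \<delta> * (\<mu> + R t) + 2 * r s" if "s \<le> t" for s
  proof -
    have "S s * \<phi> s - G s = (\<Sum>k\<le>s. F k * (\<phi> s - \<phi> (s - k)))"
      by (simp add: S_def G_def sum_distrib_right right_diff_distrib sum_subtractf)
    also have "\<bar>\<dots>\<bar> \<le> (\<Sum>k\<le>s. F k * (real k * (1 - a)))"
    proof (intro order_trans[OF sum_abs] sum_mono)
      fix k assume "k \<in> {..s}"
      then show "\<bar>F k * (\<phi> s - \<phi> (s - k))\<bar> \<le> F k * (real k * (1 - a))"
        using abs_diff_le_Lipschitz[of \<phi> "1 - a" "s - k" k] \<phi>(2) F(1)[of k]
        by (simp add: abs_mult mult_left_mono)
    qed
    also have "\<dots> = (1 - a) * (\<Sum>k\<le>s. real k * F k)"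
      by (simp add: sum_distrib_left mult_ac)
    also have "\<dots> \<le> \<delta> * R t"
      using r_sum[OF that] a\<delta> \<delta>0 a F(1) by (intro mult_mono) (auto intro!: sum_nonneg)
    finally have 1: "\<bar>S s * \<phi> s - G s\<bar> \<le> \<delta> * R t" .
    have "a * (\<delta> * (\<Sum>k\<le>s. \<phi> k)) = a * (S s + \<delta> * S s - G s)"
    proof -
      have "a * \<delta> = 1 - a" using a by (simp add: \<delta>_def)
      then have "a * (\<delta> * (\<Sum>k\<le>s. \<phi> k)) = (1 - a) * (\<Sum>k\<le>s. \<phi> k)"
        and "a * (S s + \<delta> * S s - G s) = a * S s + (1 - a) * S s - a * G s"
        by (simp_all add: mult.assoc[symmetric] distrib_left right_diff_distrib)
      then show ?thesis using average[of s] by (simp add: S_def G_def left_diff_distrib)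
    qed
    then have "\<delta> * (\<Sum>k\<le>s. \<phi> k) = S s + \<delta> * S s - G s" using a by simp
    then have 2: "E s = \<delta> * S s - r s + (S s * \<phi> s - G s) + r s * \<phi> s"
      by (simp add: E_def r_def S_def algebra_simps)
    have 3: "\<bar>\<delta> * S s\<bar> \<le> \<delta> * \<mu>"
      using r0[of s] \<delta>0 F(1) by (auto simp: abs_mult S_def r_def sum_nonneg intro!: mult_left_mono)
    have 4: "\<bar>r s * \<phi> s\<bar> \<le> r s"
      using r0[of s] \<phi>(1)[of s] by (simp add: abs_mult mult_left_le)
    have "\<bar>E s\<bar> \<le> \<bar>\<delta> * S s\<bar> + \<bar>r s\<bar> + \<bar>S s * \<phi> s - G s\<bar> + \<bar>r s * \<phi> s\<bar>" unfolding 2 by linarith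
    with 1 3 4 r0[of s] show ?thesis by (simp add: algebra_simps)
  qed
  have pos: "1 + \<delta> / \<mu> > 0" using \<delta>0 F(3) by (simp add: add_pos_nonneg)
  have g_eq: "\<mu> * g s + \<delta> * (\<Sum>k\<le>s. g k) = \<mu>" for s
  proof (induction s)
    case 0
    have "\<mu> * g 0 + \<delta> * g 0 = \<mu> * ((1 + \<delta> / \<mu>) * g 0)" using F(3) by (simp add: field_simps)
    also have "(1 + \<delta> / \<mu>) * g 0 = 1" using pos by (simp add: g_def)
    finally show ?case by simp
  next
    case (Suc s)
    have "g s = (1 + \<delta> / \<mu>) * g (Suc s)" using pos by (simp add: g_def)
    then have "\<mu> * g s = (\<mu> + \<delta>) * g (Suc s)" using F(3) by (simp add: field_simps)
    with Suc show ?case by (simp add: algebra_simps)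
  qed
  have D_eq: "\<mu> * (\<phi> s - g s) + \<delta> * D s = E s" for s
    using g_eq[of s] by (simp add: D_def E_def sum_subtractf algebra_simps)
  \<comment> \<open>As \<open>D (Suc s) - D s\<close> is the new difference, \<open>D_eq\<close>
    becomes the recursion \<open>(\<mu> + \<delta>) * D (Suc s) = E (Suc s) + \<mu> * D s\<close>.
    Because \<open>\<delta> \<ge> 0\<close>, earlier defects are never amplified and merely add
    up.\<close>
  have D_bound: "\<mu> * \<bar>D s\<bar> \<le> (\<Sum>k\<le>s. \<bar>E k\<bar>)" for s
  proof (induction s)
    case 0
    have "(\<mu> + \<delta>) * D 0 = E 0" using D_eq[of 0] by (simp add: D_def algebra_simps)
    then have "(\<mu> + \<delta>) * \<bar>D 0\<bar> = \<bar>E 0\<bar>" using F(3) \<delta>0 by (metis abs_mult abs_of_pos add_pos_nonneg)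
    then show ?case using \<delta>0 by (simp add: algebra_simps)
        (smt (verit) mult_nonneg_nonneg)
  next
    case (Suc s)
    have "(\<mu> + \<delta>) * D (Suc s) = E (Suc s) + \<mu> * D s"
      using D_eq[of "Suc s"] by (simp add: D_def algebra_simps)
    then have "(\<mu> + \<delta>) * \<bar>D (Suc s)\<bar> = \<bar>E (Suc s) + \<mu> * D s\<bar>"
      using F(3) \<delta>0 by (metis abs_mult abs_of_pos add_pos_nonneg)
    also have "\<dots> \<le> \<bar>E (Suc s)\<bar> + \<mu> * \<bar>D s\<bar>"
      using F(3) abs_triangle_ineq[of "E (Suc s)" "\<mu> * D s"] by (simp add: abs_mult)
    finally have "\<delta> * \<bar>D (Suc s)\<bar> + \<mu> * \<bar>D (Suc s)\<bar> \<le> \<bar>E (Suc s)\<bar> + \<mu> * \<bar>D s\<bar>"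
      by (simp add: distrib_right)
    moreover have "\<delta> * \<bar>D (Suc s)\<bar> \<ge> 0" using \<delta>0 by simp
    ultimately have "\<mu> * \<bar>D (Suc s)\<bar> \<le> \<bar>E (Suc s)\<bar> + (\<Sum>k\<le>s. \<bar>E k\<bar>)" using Suc by linarith
    then show ?case by simp
  qed
  have "(\<Sum>k\<le>t. \<bar>E k\<bar>) \<le> (\<Sum>k\<le>t. \<delta> * (\<mu> + R t) + 2 * r k)"
    using E_bound by (intro sum_mono) auto
  also have "\<dots> = real (Suc t) * (\<delta> * (\<mu> + R t)) + 2 * R t"
    by (simp add: sum.distrib R_def sum_distrib_left)
  finally have "\<bar>D t\<bar> \<le> (real (Suc t) * (\<delta> * (\<mu> + R t)) + 2 * R t) / \<mu>"
    using D_bound[of t] F(3) by (simp add: field_simps)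
  from mult_left_mono[OF this \<delta>0]
  have "\<delta> * \<bar>D t\<bar> \<le> \<delta> / \<mu> * (real (Suc t) * (\<delta> * (\<mu> + R t)) + 2 * R t)"
    by simp
  moreover have "\<mu> * \<bar>\<phi> t - g t\<bar> \<le> \<bar>E t\<bar> + \<delta> * \<bar>D t\<bar>"
  proof -
    have "\<mu> * (\<phi> t - g t) = E t - \<delta> * D t" using D_eq[of t] by simp
    then have "\<mu> * \<bar>\<phi> t - g t\<bar> = \<bar>E t - \<delta> * D t\<bar>" using F(3) by (metis abs_mult abs_of_pos)
    also have "\<dots> \<le> \<bar>E t\<bar> + \<delta> * \<bar>D t\<bar>"
      using \<delta>0 abs_triangle_ineq4[of "E t" "\<delta> * D t"] by (simp add: abs_mult)
    finally show ?thesis .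
  qed
  ultimately have "\<mu> * \<bar>\<phi> t - g t\<bar> \<le> \<delta> / \<mu> * (real (Suc t) * (\<delta> * (\<mu> + R t)) + 2 * R t) + (\<delta> * (\<mu> + R t) + 2 * r t)"
    using E_bound[of t] by linarith
  then show ?thesis using F(3) unfolding g_def by (simp add: pos_le_divide_eq mult.commute)
qed

section \<open>The scaling limit at frequencies of order \<open>1 / sqrt t\<close>\<close>

lemma cos_odds_limits:
  fixes u \<mu> :: real
  assumes "\<mu> > 0"
  defines "\<delta> \<equiv> \<lambda>t. (1 - cos (u / sqrt (real t / \<mu>))) / cos (u / sqrt (real t / \<mu>))"
  shows "(\<lambda>t. real (Suc t) * \<delta> t) \<longlonglongrightarrow> \<mu> * u\<^sup>2 / 2"
    and "(\<lambda>t. 1 / (1 + \<delta> t / \<mu>) ^ Suc t) \<longlonglongrightarrow> exp (- (u\<^sup>2) / 2)"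
proof -
  \<comment> \<open>Absorbing \<open>\<mu>\<close> into \<open>v\<close> leaves the angle
    \<open>v / sqrt t\<close>. From \<open>1 - cos x\<close> being asymptotic to
    \<open>x^2 / 2\<close>, \<open>\<delta> t\<close> behaves like \<open>v^2 / (2 * t)\<close>,
    which gives both limits.\<close>
  define v where "v = u * sqrt \<mu>"
  have \<delta>: "\<delta> = (\<lambda>t. (1 - cos (v / sqrt (real t))) / cos (v / sqrt (real t)))"
    by (simp add: \<delta>_def v_def real_sqrt_divide)
  have v2: "v\<^sup>2 = \<mu> * u\<^sup>2" using assms(1) by (simp add: v_def power_mult_distrib)
  have "(\<lambda>t. real (Suc t) * \<delta> t) \<longlonglongrightarrow> v\<^sup>2 / 2"
    unfolding \<delta> by (real_asymp simp add: power2_eq_square)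
  then show "(\<lambda>t. real (Suc t) * \<delta> t) \<longlonglongrightarrow> \<mu> * u\<^sup>2 / 2" by (simp add: v2)
  have "(\<lambda>t. 1 / (1 + \<delta> t / \<mu>) ^ Suc t) \<longlonglongrightarrow> exp (- (v\<^sup>2 / \<mu>) / 2)"
    using assms(1) unfolding \<delta> by (real_asymp simp add: power2_eq_square field_simps exp_minus inverse_eq_divide)
  then show "(\<lambda>t. 1 / (1 + \<delta> t / \<mu>) ^ Suc t) \<longlonglongrightarrow> exp (- (u\<^sup>2) / 2)"
    using assms(1) by (simp add: v2)
qed

text \<open>The frequency changes with the horizon, so the first index of \<open>\<phi>\<close> and
  \<open>w\<close> selects the frequency and the second is time; the limit runs along the diagonal.
  It follows because the geometric bound tends to zero uniformly enough to be used at each frequency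
  separately.\<close>

lemma renewal_scaling_limit:
  fixes F :: "nat \<Rightarrow> real" and \<phi> w :: "nat \<Rightarrow> nat \<Rightarrow> real" and u \<mu> :: real
  defines "a \<equiv> \<lambda>t. cos (u / sqrt (real t / \<mu>))"
  assumes F: "\<And>k. F k \<ge> 0" "F sums \<mu>" "\<mu> > 0" "F 0 = 1"
    and bounds: "\<And>t k. \<phi> t 0 = 1" "\<And>t k. \<bar>\<phi> t k\<bar> \<le> 1" "\<And>t k. \<bar>w t k\<bar> \<le> 1"
    and step: "\<And>t k. \<phi> t (Suc k) = \<phi> t k - (1 - a t) * w t k"
    and renewal: "\<And>t k. \<phi> t k = F k + a t * (\<Sum>s<k. w t s * F (k - Suc s))"
  shows "(\<lambda>t. \<phi> t t) \<longlonglongrightarrow> exp (- (u\<^sup>2) / 2)"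
proof -
  define \<delta> where "\<delta> = (\<lambda>t. (1 - a t) / a t)"
  define r where "r = (\<lambda>s. \<mu> - (\<Sum>k\<le>s. F k))"
  define R where "R = (\<lambda>t. \<Sum>s\<le>t. r s)"
  define n\<delta> where "n\<delta> = (\<lambda>t. real (Suc t) * \<delta> t)"
  define C where "C = (\<lambda>t. R t / real (Suc t))"
  define B where "B = (\<lambda>t. (\<delta> t / \<mu> * (real (Suc t) * (\<delta> t * (\<mu> + R t)) + 2 * R t)
    + (\<delta> t * (\<mu> + R t) + 2 * r t)) / \<mu>)"
  have n\<delta>_lim: "n\<delta> \<longlonglongrightarrow> \<mu> * u\<^sup>2 / 2" and exp_lim: "(\<lambda>t. 1 / (1 + \<delta> t / \<mu>) ^ Suc t) \<longlonglongrightarrow> exp (- (u\<^sup>2) / 2)"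
    using cos_odds_limits[OF F(3), of u] by (simp_all add: n\<delta>_def \<delta>_def a_def)
  have \<delta>_lim: "\<delta> \<longlonglongrightarrow> 0"
  proof -
    have "(\<lambda>t. n\<delta> t * inverse (real (Suc t))) \<longlonglongrightarrow> \<mu> * u\<^sup>2 / 2 * 0"
      by (intro tendsto_mult n\<delta>_lim LIMSEQ_inverse_real_of_nat)
    then show ?thesis by (simp add: n\<delta>_def field_simps del: of_nat_Suc)
  qed
  have r_lim: "r \<longlonglongrightarrow> 0"
    using F(2) unfolding sums_def_le r_def by (auto intro!: tendsto_eq_intros)
  have C_lim: "C \<longlonglongrightarrow> 0" unfolding C_def R_def by (rule Cesaro_mean_null[OF r_lim])
  \<comment> \<open>The growing factors are paired with the small ones:
    \<open>real (Suc t) * \<delta> t\<close> is \<open>n\<delta> t\<close>, which converges, and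
    \<open>\<delta> t * R t\<close> is \<open>n\<delta> t * C t\<close>. After this every term
    carries a factor \<open>\<delta>\<close>, \<open>C\<close> or \<open>r\<close> that tends to
    zero.\<close>
  have "B = (\<lambda>t. (n\<delta> t * (\<delta> t * \<mu> + n\<delta> t * C t) + 2 * n\<delta> t * C t) / \<mu> / \<mu> +
      (\<delta> t * \<mu> + n\<delta> t * C t + 2 * r t) / \<mu>)"
  proof
    fix t
    have R: "R t = real (Suc t) * C t" by (simp add: C_def del: of_nat_Suc)
    show "B t = (n\<delta> t * (\<delta> t * \<mu> + n\<delta> t * C t) + 2 * n\<delta> t * C t) / \<mu> / \<mu> +
      (\<delta> t * \<mu> + n\<delta> t * C t + 2 * r t) / \<mu>"
      using F(3) by (simp add: B_def R n\<delta>_def field_simps del: of_nat_Suc)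
  qed
  moreover have "\<dots> \<longlonglongrightarrow> (\<mu> * u\<^sup>2 / 2 * (0 * \<mu> + \<mu> * u\<^sup>2 / 2 * 0) + 2 * (\<mu> * u\<^sup>2 / 2) * 0) / \<mu> / \<mu> +
      (0 * \<mu> + \<mu> * u\<^sup>2 / 2 * 0 + 2 * 0) / \<mu>"
    using F(3) by (intro tendsto_intros n\<delta>_lim \<delta>_lim C_lim r_lim) auto
  ultimately have B_lim: "B \<longlonglongrightarrow> 0" by simp
  have "a \<longlonglongrightarrow> 1"
    using F(3) unfolding a_def by real_asymp
  \<comment> \<open>For small \<open>t\<close> the cosine may be nonpositive, where the geometric
    bound does not apply.\<close>
  then have "eventually (\<lambda>t. a t > 0) sequentially"
    by (rule order_tendstoD) simp
  then have "eventually (\<lambda>t. norm (\<phi> t t - 1 / (1 + \<delta> t / \<mu>) ^ Suc t) \<le> B t) sequentially"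
  proof eventually_elim
    case (elim t)
    have a: "0 < a t" "a t \<le> 1" using elim by (auto simp: a_def)
    have lip: "\<bar>\<phi> t (Suc k) - \<phi> t k\<bar> \<le> 1 - a t" for k
      using mult_left_mono[OF bounds(3)[of t k], of "1 - a t"] a by (simp add: step abs_mult)
    have "\<phi> t (Suc k) = F (Suc k) + a t * (\<Sum>s\<le>k. F s * w t (k - s))" for k
      by (subst renewal, subst sum.nat_diff_reindex[symmetric])
        (auto simp: lessThan_Suc_atMost mult.commute intro!: sum.cong)
    from renewal_average_identity[of "\<phi> t" F "a t" "w t", OF bounds(1) F(4) step this]
    have avg: "(1 - a t) * (\<Sum>k\<le>s. \<phi> t k) = (\<Sum>k\<le>s. F k) - a t * (\<Sum>k\<le>s. F k * \<phi> t (s - k))" for s .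
    show ?case
      using renewal_geometric_bound[OF F(1-3) a bounds(2)[of t] lip avg, of t]
      by (simp only: B_def \<delta>_def r_def R_def real_norm_def)
  qed
  from Lim_null_comparison[OF this B_lim] exp_lim show ?thesis
    by (rule Lim_transform[rotated])
qed

section \<open>Laws of Markov chains\<close>

text \<open>A \<open>pmf\<close> turns the evolution of the chain into \<open>bind_pmf\<close>. The
  value is the actual distribution when \<open>M\<close> is a probability space and \<open>Z\<close>
  is measurable, by \<open>measure_pmf_law\<close>.\<close>

definition law :: "'a measure \<Rightarrow> ('a \<Rightarrow> 's::countable) \<Rightarrow> 's pmf" where
  "law M Z = Abs_pmf (distr M (count_space UNIV) Z)"

context prob_space
begin

lemma measure_pmf_law:
  assumes Z: "Z \<in> measurable M (count_space UNIV)"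
  shows "measure_pmf (law M Z) = distr M (count_space UNIV) Z"
proof -
  interpret D: prob_space "distr M (count_space UNIV) Z" using Z by (rule prob_space_distr)
  have "AE x in distr M (count_space UNIV) Z. measure (distr M (count_space UNIV) Z) {x} \<noteq> 0"
    by (subst D.AE_support_countable) (auto intro!: exI[of _ UNIV])
  then show ?thesis unfolding law_def
    by (intro Abs_pmf_inverse) (auto intro: D.prob_space_axioms)
qed

lemma pmf_law:
  assumes "Z \<in> measurable M (count_space UNIV)"
  shows "pmf (law M Z) s = \<P>(\<omega> in M. Z \<omega> = s)"
  unfolding pmf.rep_eq measure_pmf_law[OF assms]
  using assms by (subst measure_distr) (auto intro!: arg_cong[where f=prob])

lemma law_comp:
  assumes "Z \<in> measurable M (count_space UNIV)"
  shows "law M (\<lambda>\<omega>. f (Z \<omega>)) = map_pmf f (law M Z)"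
proof -
  have "(\<lambda>\<omega>. f (Z \<omega>)) \<in> measurable M (count_space UNIV)" using assms by simp
  from measure_pmf_law[OF this] show ?thesis
    using assms by (intro measure_pmf_inject[THEN iffD1])
      (simp add: map_pmf_rep_eq measure_pmf_law distr_distr comp_def)
qed

end

text \<open>Only the fibre over \<open>x\<close> contributes, because each inner sample retains its
  first coordinate.\<close>

lemma pmf_bind_Pair:
  "pmf (bind_pmf A (\<lambda>x. map_pmf (Pair x) (B x))) (x, y) = pmf A x * pmf (B x) y"
proof -
  have "pmf (map_pmf (Pair x') (B x')) (x, y) = indicator {x} x' * pmf (B x) y" for x'
  proof (cases "x' = x")
    case True
    then show ?thesis by (simp add: pmf_map_inj' inj_def)
  next
    case False
    then have "(x, y) \<notin> set_pmf (map_pmf (Pair x') (B x'))" by auto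
    then have "pmf (map_pmf (Pair x') (B x')) (x, y) = 0" unfolding set_pmf_iff by blast
    with False show ?thesis by simp
  qed
  then show ?thesis by (simp add: pmf_bind measure_pmf_single)
qed

text \<open>The Markov property conditions on the whole past, so the kernel is first attached to the
  law of the history, acting on its last entry; projecting the joint law of history and next state
  to the latter then forgets the past.\<close>

lemma (in markov_chain) law_Suc:
  assumes K: "\<And>y y'. P y y' = pmf (K y) y'"
  shows "law M (Y (Suc t)) = bind_pmf (law M (Y t)) K"
proof -
  \<comment> \<open>Histories are encoded as finite lists, which form a countable type over a
    countable state space, so that \<open>H\<close> has a discrete law.\<close>
  define H where "H = (\<lambda>\<omega>. map (\<lambda>i. Y i \<omega>) [0..<Suc t])"
  have H_eq: "H \<omega> = h \<longleftrightarrow> length h = Suc t \<and> (\<forall>i\<le>t. Y i \<omega> = h ! i)" for \<omega> h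
    by (auto simp: H_def list_eq_iff_nth_eq less_Suc_eq_le nth_append simp del: upt_Suc)
  note [measurable] = measurable_state
  have H [measurable]: "H \<in> measurable M (count_space UNIV)"
    unfolding measurable_count_space_eq2_countable
  proof safe
    fix h
    have "H -` {h} \<inter> space M = {\<omega> \<in> space M. length h = Suc t \<and> (\<forall>i\<le>t. Y i \<omega> = h ! i)}"
      using H_eq by auto
    also have "\<dots> \<in> sets M" by measurable
    finally show "H -` {h} \<inter> space M \<in> sets M" .
  qed simp
  have HY: "(\<lambda>\<omega>. (H \<omega>, Y (Suc t) \<omega>)) \<in> measurable M (count_space UNIV)"
    by (rule measurable_compose_countable[OF _ H]) measurable
  have "law M (\<lambda>\<omega>. (H \<omega>, Y (Suc t) \<omega>)) = bind_pmf (law M H) (\<lambda>h. map_pmf (Pair h) (K (last h)))"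
  proof (rule pmf_eqI, safe)
    fix h y'
    have "\<P>(\<omega> in M. Y (Suc t) \<omega> = y' \<and> H \<omega> = h) = \<P>(\<omega> in M. H \<omega> = h) * pmf (K (last h)) y'"
    proof (cases "\<P>(\<omega> in M. H \<omega> = h) = 0")
      \<comment> \<open>\<open>transition\<close> says nothing about null histories; there both
        sides vanish by monotonicity.\<close>
      case True
      have "\<P>(\<omega> in M. Y (Suc t) \<omega> = y' \<and> H \<omega> = h) \<le> \<P>(\<omega> in M. H \<omega> = h)"
        by (intro finite_measure_mono) auto
      with True show ?thesis by (simp add: measure_le_0_iff)
    next
      case False
      \<comment> \<open>A list of the wrong length is never attained, so it would have probability
        zero.\<close>
      then have len: "length h = Suc t" using H_eq by (auto simp: set_eq_iff intro: ccontr)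
      then have last: "last h = h ! t" by (subst last_conv_nth) auto
      from len have eq: "H \<omega> = h \<longleftrightarrow> (\<forall>i\<le>t. Y i \<omega> = h ! i)" for \<omega> using H_eq by simp
      have "\<P>(\<omega> in M. \<forall>i\<le>t. Y i \<omega> = h ! i) > 0"
        using False by (simp add: eq zero_less_measure_iff)
      from transition[OF this, of y'] False show ?thesis
        using len by (simp add: cond_prob_def eq K last field_simps)
    qed
    then show "pmf (law M (\<lambda>\<omega>. (H \<omega>, Y (Suc t) \<omega>))) (h, y') =
        pmf (bind_pmf (law M H) (\<lambda>h. map_pmf (Pair h) (K (last h)))) (h, y')"
      by (simp add: pmf_law HY pmf_law[OF H] pmf_bind_Pair conj_commute)
  qed
  then have "map_pmf snd (law M (\<lambda>\<omega>. (H \<omega>, Y (Suc t) \<omega>))) = bind_pmf (map_pmf last (law M H)) K"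
    by (simp add: map_bind_pmf bind_map_pmf map_pmf_comp)
  moreover have "(\<lambda>\<omega>. last (H \<omega>)) = Y t" by (simp add: H_def fun_eq_iff)
  ultimately show ?thesis using law_comp[OF HY, of snd] law_comp[OF H, of last] by simp
qed

section \<open>The trapped random walk\<close>

lemma integral_bind_pmf_bounded:
  fixes f :: "'b \<Rightarrow> real"
  assumes "\<And>x. \<bar>f x\<bar> \<le> B"
  shows "(\<integral>x. f x \<partial>bind_pmf A K) = (\<integral>x. \<integral>y. f y \<partial>K x \<partial>A)"
  unfolding measure_pmf_bind
  by (rule integral_bind[where K = "count_space UNIV" and B = B and B' = 1])
    (use assms measurable_measure_pmf[of K] in \<open>auto simp: measure_pmf.emeasure_space_1\<close>)

text \<open>\<open>trapped_step\<close> is only a real matrix; \<open>law_Suc\<close> needs a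
  stochastic kernel with the same entries.\<close>

definition trapped_kernel :: "nat pmf \<Rightarrow> int \<times> nat \<Rightarrow> (int \<times> nat) pmf" where
  "trapped_kernel p = (\<lambda>(z, \<tau>). case \<tau> of
     0 \<Rightarrow> pair_pmf (map_pmf (\<lambda>b. if b then z + 1 else z - 1) (bernoulli_pmf (1 / 2))) p
   | Suc n \<Rightarrow> return_pmf (z, n))"

lemma trapped_step_eq_pmf: "trapped_step p y y' = pmf (trapped_kernel p y) y'"
proof -
  obtain z \<tau> z' \<tau>' where y: "y = (z, \<tau>)" "y' = (z', \<tau>')" by fastforce
  have "pmf (map_pmf (\<lambda>b. if b then z + 1 else z - 1) (bernoulli_pmf (1 / 2))) z' =
      (if \<bar>z - z'\<bar> = 1 then 1 / 2 else 0)"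
  proof -
    have "pmf (map_pmf f (bernoulli_pmf (1 / 2))) z' = (\<integral>b. indicator {z'} (f b) \<partial>bernoulli_pmf (1 / 2))"
      for f :: "bool \<Rightarrow> int"
      by (subst integral_map_pmf[symmetric]) (simp add: measure_pmf_single)
    then show ?thesis by (auto simp: indicator_def)
  qed
  then show ?thesis
    by (auto simp: y trapped_step_def trapped_kernel_def pmf_pair indicator_def split: nat.split)
qed

lemma integral_of_bool_le_pmf: "(\<integral>n. of_bool (j \<le> n) \<partial>measure_pmf p) = measure p {j..}"
proof -
  have "(\<lambda>n. of_bool (j \<le> n)) = indicat_real {j..}" by (auto simp: fun_eq_iff indicator_def)
  then show ?thesis by simp
qed

text \<open>\<open>e\<close> is an eigenfunction of averaging over the two neighbours, with
  eigenvalue \<open>a\<close>. At \<open>\<tau> = 0\<close> direction and new trapping time are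
  independent and the integral factors; otherwise only the clock moves, which shifts the threshold
  \<open>j\<close> by one.\<close>

lemma integral_trapped_kernel:
  fixes e :: "int \<Rightarrow> real"
  assumes e: "\<And>z. (e (z + 1) + e (z - 1)) / 2 = a * e z" and bound: "\<And>z. \<bar>e z\<bar> \<le> 1"
  shows "(\<integral>y. e (fst y) * of_bool (j \<le> snd y) \<partial>trapped_kernel p (z, \<tau>)) =
    (if \<tau> = 0 then a * e z * measure p {j..} else e z * of_bool (Suc j \<le> \<tau>))"
proof (cases \<tau>)
  case 0
  have "\<bar>e (fst y) * of_bool (j \<le> snd y)\<bar> \<le> 1" for y
    using bound[of "fst y"] by (simp add: of_bool_def)
  then show ?thesis
    using 0 e[of z]
    by (simp add: trapped_kernel_def integral_of_bool_le_pmf pair_pmf_def integral_bind_pmf_bounded[where B = 1])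
qed (simp add: trapped_kernel_def)

text \<open>One step gives \<open>V (Suc t) j = a * w t * F j + V t (Suc j)\<close>. Iterating down
  to time 0 yields the renewal equation; taking \<open>j = 0\<close> and splitting
  \<open>V t 0 = w t + V t 1\<close> yields the step relation. The factor \<open>e 0\<close> is kept
  so that both cosine and sine are covered.\<close>

lemma trapped_kernel_renewal:
  fixes e :: "int \<Rightarrow> real" and \<pi> :: "nat \<Rightarrow> (int \<times> nat) pmf"
  assumes e: "\<And>z. (e (z + 1) + e (z - 1)) / 2 = a * e z" and bound: "\<And>z. \<bar>e z\<bar> \<le> 1"
    and \<pi>0: "\<pi> 0 = map_pmf (Pair 0) p"
    and \<pi>Suc: "\<And>t. \<pi> (Suc t) = bind_pmf (\<pi> t) (trapped_kernel p)"
  defines "F \<equiv> \<lambda>k. measure p {k..}"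
    and "\<phi> \<equiv> \<lambda>t. \<integral>y. e (fst y) \<partial>\<pi> t"
    and "w \<equiv> \<lambda>t. \<integral>y. e (fst y) * of_bool (snd y = 0) \<partial>\<pi> t"
  shows "\<phi> (Suc t) = \<phi> t - (1 - a) * w t"
    and "\<phi> t = e 0 * F t + a * (\<Sum>s<t. w s * F (t - Suc s))"
proof -
  \<comment> \<open>Tail events \<open>{j \<le> T\<^sub>t}\<close> instead of \<open>{T\<^sub>t = j}\<close>: their recursion closes without a sum over \<open>j\<close>.\<close>
  define V where "V = (\<lambda>t j. \<integral>y. e (fst y) * of_bool (j \<le> snd y) \<partial>\<pi> t)"
  have bounded: "\<bar>e (fst y) * of_bool Q\<bar> \<le> 1" for y :: "int \<times> nat" and Q
    using bound[of "fst y"] by (simp add: of_bool_def)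
  have int: "integrable (\<pi> t) (\<lambda>y. e (fst y) * of_bool (Q y))" for t Q
    by (rule measure_pmf.integrable_const_bound[where B = 1]) (auto simp: bounded)
  have V_Suc: "V (Suc t) j = a * w t * F j + V t (Suc j)" for t j
  proof -
    have "V (Suc t) j = (\<integral>x. \<integral>y. e (fst y) * of_bool (j \<le> snd y) \<partial>trapped_kernel p x \<partial>\<pi> t)"
      unfolding V_def \<pi>Suc by (intro integral_bind_pmf_bounded[where B = 1] bounded)
    also have "\<dots> = (\<integral>x. a * F j * (e (fst x) * of_bool (snd x = 0)) +
        e (fst x) * of_bool (Suc j \<le> snd x) \<partial>\<pi> t)"
      by (intro Bochner_Integration.integral_cong refl, clarify)
        (simp add: integral_trapped_kernel[OF e bound] F_def)
    also have "\<dots> = a * w t * F j + V t (Suc j)"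
      using int[of t "\<lambda>y. snd y = 0"] int[of t "\<lambda>y. Suc j \<le> snd y"]
      by (subst Bochner_Integration.integral_add) (auto simp: w_def V_def)
    finally show ?thesis .
  qed
  have V_eq: "V t j = e 0 * F (t + j) + a * (\<Sum>s<t. w s * F (t - Suc s + j))" for t j
  proof (induction t arbitrary: j)
    case 0
    show ?case by (simp add: V_def \<pi>0 F_def integral_of_bool_le_pmf)
  next
    case (Suc t)
    have "(\<Sum>s<t. w s * F (t - Suc s + Suc j)) = (\<Sum>s<t. w s * F (t - s + j))"
      by (intro sum.cong) (auto simp: Suc_diff_Suc)
    with Suc[of "Suc j"] show ?case by (simp add: V_Suc algebra_simps)
  qed
  have \<phi>V: "\<phi> t = V t 0" for t by (simp add: \<phi>_def V_def)
  have "V t 0 = w t + V t (Suc 0)"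
    unfolding V_def w_def
    by (subst Bochner_Integration.integral_add[symmetric])
      (auto intro!: int Bochner_Integration.integral_cong)
  then show "\<phi> (Suc t) = \<phi> t - (1 - a) * w t"
    by (simp add: \<phi>V V_Suc F_def measure_pmf.prob_space[simplified] algebra_simps)
  show "\<phi> t = e 0 * F t + a * (\<Sum>s<t. w s * F (t - Suc s))"
    using V_eq[of t 0] by (simp add: \<phi>V)
qed

section \<open>Tail sums, bounded expectations and the passage from characteristic functions to
  intervals\<close>

lemma tail_sums_expectation:
  fixes p :: "nat pmf"
  assumes "integrable p real"
  shows "(\<lambda>k. measure p {k..}) sums (measure_pmf.expectation p real + 1)"
proof -
  have "(\<Sum>t. emeasure p {x \<in> space p. t < x}) = (\<integral>\<^sup>+x. of_nat x \<partial>p)"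
    by (rule nn_integral_nat_function[symmetric]) simp
  also have "\<dots> = ennreal (measure_pmf.expectation p real)"
    using assms by (subst nn_integral_eq_integral[symmetric]) (auto simp: ennreal_of_nat_eq_real_of_nat comp_def intro!: nn_integral_cong)
  finally have "(\<lambda>t. ennreal (measure p {Suc t..})) sums ennreal (measure_pmf.expectation p real)"
    by (auto simp: sums_iff measure_pmf.emeasure_eq_measure atLeast_def Suc_le_eq)
  then have "(\<lambda>t. measure p {Suc t..}) sums measure_pmf.expectation p real"
    by (subst (asm) sums_ennreal) (auto intro: integral_nonneg)
  \<comment> \<open>The layer-cake sum starts at threshold 1; restoring the term
    \<open>k = 0\<close>, which equals 1, produces the \<open>+ 1\<close> in
    \<open>\<mu>\<close>.\<close>
  from sums_Suc[OF this] show ?thesis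
    using measure_pmf.prob_space[of p] by simp
qed

lemma abs_expectation_pmf_le:
  fixes f :: "'a \<Rightarrow> real"
  assumes "\<And>x. \<bar>f x\<bar> \<le> c"
  shows "\<bar>measure_pmf.expectation p f\<bar> \<le> c"
proof -
  have "integrable p f" by (rule measure_pmf.integrable_const_bound[where B = c]) (use assms in auto)
  then show ?thesis
    using assms measure_pmf.integral_le_const[of p f c] measure_pmf.integral_ge_const[of p f "- c"]
    by (simp add: abs_le_iff minus_le_iff)
qed

text \<open>Levy continuity gives weak convergence. The frontier of an interval is Lebesgue null,
  being the frontier of a convex set, hence null for the absolutely continuous normal law, so
  \<open>I\<close> is a continuity set.\<close>

lemma char_tendsto_std_normal_imp_interval:
  fixes D :: "nat \<Rightarrow> real measure" and I :: "real set"
  assumes D: "\<And>t. real_distribution (D t)"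
    and char: "\<And>u. (\<lambda>t. char (D t) u) \<longlonglongrightarrow> complex_of_real (exp (- (u\<^sup>2) / 2))"
    and I: "is_interval I"
  shows "(\<lambda>t. measure (D t) I) \<longlonglongrightarrow> 1 / sqrt (2 * pi) * (LBINT x:I. exp (- (x\<^sup>2) / 2))"
proof -
  have I_borel [measurable]: "I \<in> sets borel"
    using I by (intro real_interval_borel_measurable)
  have weak: "weak_conv_m D std_normal_distribution"
    using D real_dist_normal_dist char by (intro levy_continuity) (auto simp: char_std_normal_distribution)
  have "negligible (frontier I)"
    using I by (intro negligible_convex_frontier) (simp add: is_interval_convex_1)
  then have "frontier I \<in> null_sets lborel"
    by (simp add: negligible_iff_null_sets null_sets_completion_iff borel_closed)
  moreover have "absolutely_continuous lborel std_normal_distribution"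
    by (rule absolutely_continuousI_density) simp
  ultimately have "frontier I \<in> null_sets std_normal_distribution"
    unfolding absolutely_continuous_def by blast
  then have front: "emeasure std_normal_distribution (frontier I) = 0"
    by (rule null_setsD1)
  have "measure std_normal_distribution I = (\<integral>x. std_normal_density x * indicator I x \<partial>lborel)"
  proof -
    interpret real_distribution std_normal_distribution by (rule real_dist_normal_dist)
    have "measure std_normal_distribution I = (\<integral>x. indicator I x \<partial>std_normal_distribution)" by simp
    also have "\<dots> = (\<integral>x. std_normal_density x *\<^sub>R indicator I x \<partial>lborel)"
      by (rule integral_density) (auto simp: normal_density_nonneg)
    finally show ?thesis by simp
  qed
  also have "\<dots> = 1 / sqrt (2 * pi) * (LBINT x:I. exp (- (x\<^sup>2) / 2))"
    unfolding set_lebesgue_integral_def integral_mult_right_zero[symmetric]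
    by (intro Bochner_Integration.integral_cong) (auto simp: std_normal_density_def indicator_def)
  finally have "measure std_normal_distribution I = \<dots>" .
  with weak_conv_imp_continuity_set_conv[OF D real_dist_normal_dist weak I_borel front]
  show ?thesis by simp
qed

section \<open>Convergence of characteristic functions and interval probabilities for the
  walk\<close>

theorem theorem3:
  fixes p :: "nat pmf"
    and N :: "'b measure" and T :: "'b \<Rightarrow> nat"
    and M :: "'a measure" and XT :: "nat \<Rightarrow> 'a \<Rightarrow> int \<times> nat"
    and \<mu> :: real and I :: "real set"
  assumes "prob_space N"
    and "T \<in> measurable N (count_space UNIV)"
    and "\<And>\<tau>. \<P>(\<omega> in N. T \<omega> = \<tau>) = pmf p \<tau>"
    and "trapped_random_walk M p XT"
    and "\<And>z \<tau>. \<P>(\<omega> in M. XT 0 \<omega> = (z, \<tau>)) = (if z = 0 then pmf p \<tau> else 0)"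
    and "integrable N (\<lambda>\<omega>. real (T \<omega>))"
    and "\<mu> = prob_space.expectation N (\<lambda>\<omega>. real (T \<omega>)) + 1"
    and "\<And>s :: real. s > 0 \<Longrightarrow>
      (\<lambda>\<tau> :: nat. \<P>(\<omega> in N. real (T \<omega>) \<ge> s * real \<tau>) / \<P>(\<omega> in N. T \<omega> \<ge> \<tau>))
        \<longlonglongrightarrow> inverse s"
    and "is_interval I" and "bounded I"
  shows "(\<lambda>t :: nat.
      \<bar>\<P>(\<omega> in M. real_of_int (fst (XT t \<omega>)) \<in> (\<lambda>x. sqrt (real t / \<mu>) * x) ` I)
        - 1 / sqrt (2 * pi) * (LBINT x:I. exp (- (x\<^sup>2) / 2))\<bar>) \<longlonglongrightarrow> 0"
proof -
  interpret N: prob_space N by fact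
  interpret markov_chain M "trapped_step p" XT
    using assms(4) by (simp add: trapped_random_walk_def)
  note [measurable] = measurable_state assms(2)
  define \<pi> where "\<pi> = (\<lambda>t. law M (XT t))"
  have \<pi>0: "\<pi> 0 = map_pmf (Pair 0) p"
    unfolding \<pi>_def
  proof (rule pmf_eqI, safe)
    fix z \<tau>
    have "pmf (map_pmf (Pair (0::int)) p) (z, \<tau>) = (if z = 0 then pmf p \<tau> else 0)"
      using pmf_bind_Pair[of "return_pmf 0" "\<lambda>_. p" z \<tau>] by (simp add: bind_return_pmf)
    then show "pmf (law M (XT 0)) (z, \<tau>) = pmf (map_pmf (Pair 0) p) (z, \<tau>)"
      by (simp add: pmf_law[OF measurable_state] assms(5))
  qed
  have \<pi>Suc: "\<pi> (Suc t) = bind_pmf (\<pi> t) (trapped_kernel p)" for t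
    unfolding \<pi>_def by (rule law_Suc) (rule trapped_step_eq_pmf)
  have expectation_\<pi>: "expectation (\<lambda>\<omega>. f (XT t \<omega>)) = measure_pmf.expectation (\<pi> t) f"
    for f :: "int \<times> nat \<Rightarrow> real" and t
    unfolding \<pi>_def measure_pmf_law[OF measurable_state] by (subst integral_distr) auto
  define F where "F = (\<lambda>k. measure p {k..})"
  have p: "measure_pmf p = distr N (count_space UNIV) T"
  proof -
    have "law N T = p" by (rule pmf_eqI) (simp add: N.pmf_law assms(3))
    then show ?thesis using N.measure_pmf_law[OF assms(2)] by simp
  qed
  have "integrable p real" unfolding p using assms(6) by (subst integrable_distr_eq) auto
  from tail_sums_expectation[OF this] have F_sums: "F sums \<mu>"
    unfolding F_def p assms(7) by (simp add: integral_distr)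
  have "N.expectation (\<lambda>\<omega>. real (T \<omega>)) \<ge> 0" by simp
  then have \<mu>: "\<mu> > 0" using assms(7) by linarith
  have F0: "F 0 = 1" using measure_pmf.prob_space[of p] by (simp add: F_def)

  define \<sigma> where "\<sigma> = (\<lambda>t::nat. sqrt (real t / \<mu>))"
  \<comment> \<open>At \<open>t = 0\<close> the division by \<open>\<sigma> 0 = 0\<close> gives the point mass at 0, which is irrelevant for the limit.\<close>
  define D where "D = (\<lambda>t. distr M borel (\<lambda>\<omega>. real_of_int (fst (XT t \<omega>)) / \<sigma> t))"
  have D: "real_distribution (D t)" for t
    unfolding D_def by (rule real_distribution_distr) measurable
  have char_lim: "(\<lambda>t. char (D t) u) \<longlonglongrightarrow> complex_of_real (exp (- (u\<^sup>2) / 2))" for u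
  proof -
    define \<theta> where "\<theta> = (\<lambda>t. u / \<sigma> t)"
    define \<phi> where "\<phi> = (\<lambda>t k. \<integral>y. cos (\<theta> t * real_of_int (fst y)) \<partial>\<pi> k)"
    define w where "w = (\<lambda>t k. \<integral>y. cos (\<theta> t * real_of_int (fst y)) * of_bool (snd y = 0) \<partial>\<pi> k)"
    \<comment> \<open>By the addition formulas, cosine and sine are eigenfunctions of neighbour
      averaging with the same eigenvalue \<open>cos (\<theta> t)\<close>.\<close>
    have cos_step: "(cos (\<theta> t * real_of_int (z + 1)) + cos (\<theta> t * real_of_int (z - 1))) / 2 =
        cos (\<theta> t) * cos (\<theta> t * real_of_int z)"
      and sin_step: "(sin (\<theta> t * real_of_int (z + 1)) + sin (\<theta> t * real_of_int (z - 1))) / 2 =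
        cos (\<theta> t) * sin (\<theta> t * real_of_int z)" for t z
      by (simp_all add: algebra_simps cos_add cos_diff sin_add sin_diff)
    note cos_renewal = trapped_kernel_renewal[of "\<lambda>z. cos (\<theta> t * real_of_int z)" "cos (\<theta> t)" \<pi> p for t,
        OF cos_step abs_cos_le_one \<pi>0 \<pi>Suc]
    note sin_renewal = trapped_kernel_renewal[of "\<lambda>z. sin (\<theta> t * real_of_int z)" "cos (\<theta> t)" \<pi> p for t,
        OF sin_step abs_sin_le_one \<pi>0 \<pi>Suc]
    have "(\<lambda>t. \<phi> t t) \<longlonglongrightarrow> exp (- (u\<^sup>2) / 2)"
    proof (rule renewal_scaling_limit[where \<phi> = \<phi> and w = w, OF _ F_sums \<mu> F0])
      show "\<phi> t 0 = 1" for t by (simp add: \<phi>_def \<pi>0)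
      show "\<bar>\<phi> t k\<bar> \<le> 1" for t k unfolding \<phi>_def
        by (rule abs_expectation_pmf_le) simp
      show "\<bar>w t k\<bar> \<le> 1" for t k unfolding w_def
        by (rule abs_expectation_pmf_le) (simp add: abs_mult)
      show "\<phi> t (Suc k) = \<phi> t k - (1 - cos (u / sqrt (real t / \<mu>))) * w t k" for t k
        using cos_renewal(1)[of k t] by (simp add: \<phi>_def w_def \<theta>_def \<sigma>_def)
      show "\<phi> t k = F k + cos (u / sqrt (real t / \<mu>)) * (\<Sum>s<k. w t s * F (k - Suc s))" for t k
        using cos_renewal(2)[of k t] by (simp add: \<phi>_def w_def \<theta>_def \<sigma>_def F_def)
    qed (simp add: F_def)
    moreover have "char (D t) u = complex_of_real (\<phi> t t)" for t
    proof -
      define v where "v = (\<lambda>k. \<integral>y. sin (\<theta> t * real_of_int (fst y)) * of_bool (snd y = 0) \<partial>\<pi> k)"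
      define \<psi> where "\<psi> = (\<lambda>k. \<integral>y. sin (\<theta> t * real_of_int (fst y)) \<partial>\<pi> k)"
      have \<psi>_Suc: "\<psi> (Suc k) = \<psi> k - (1 - cos (\<theta> t)) * v k"
        and \<psi>: "\<psi> k = cos (\<theta> t) * (\<Sum>s<k. v s * F (k - Suc s))" for k
        using sin_renewal(1)[of k t] sin_renewal(2)[of k t] by (simp_all add: \<psi>_def v_def F_def)
      \<comment> \<open>The sine part vanishes by uniqueness in the renewal system rather than by
        reflecting paths. As \<open>sin 0 = 0\<close>, if \<open>v\<close> vanishes before
        \<open>k\<close> then \<open>\<psi> k = 0\<close>, and the two expressions for
        \<open>\<psi> (Suc k)\<close>, namely \<open>cos (\<theta> t) * v k\<close> and
        \<open>- (1 - cos (\<theta> t)) * v k\<close>, differ by \<open>v k\<close>.\<close>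
      have v: "v k = 0" for k
      proof (induction k rule: less_induct)
        case (less k)
        then have "\<psi> k = 0" and "\<psi> (Suc k) = cos (\<theta> t) * v k" by (simp_all add: \<psi> F0)
        with \<psi>_Suc[of k] show ?case by (simp add: algebra_simps)
      qed
      let ?X = "\<lambda>\<omega>. \<theta> t * real_of_int (fst (XT t \<omega>))"
      have "char (D t) u = (CLINT \<omega>|M. iexp (?X \<omega>))"
        unfolding char_def D_def by (subst integral_distr) (auto simp: \<theta>_def)
      also have "\<dots> = (CLINT \<omega>|M. complex_of_real (cos (?X \<omega>)) + \<i> * complex_of_real (sin (?X \<omega>)))"
        by (simp add: exp_Euler cos_of_real sin_of_real flip: of_real_mult)
      also have "\<dots> = complex_of_real (expectation (\<lambda>\<omega>. cos (?X \<omega>))) + \<i> * complex_of_real (expectation (\<lambda>\<omega>. sin (?X \<omega>)))"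
        by (subst Bochner_Integration.integral_add)
          (auto intro!: integrable_const_bound[where B = 1] simp: norm_mult)
      also have "expectation (\<lambda>\<omega>. sin (?X \<omega>)) = 0"
        using \<psi>[of t] v by (simp add: expectation_\<pi>[of "\<lambda>y. sin (\<theta> t * real_of_int (fst y))"] \<psi>_def)
      also have "expectation (\<lambda>\<omega>. cos (?X \<omega>)) = \<phi> t t"
        by (simp add: expectation_\<pi>[of "\<lambda>y. cos (\<theta> t * real_of_int (fst y))"] \<phi>_def)
      finally show ?thesis by simp
    qed
    ultimately show ?thesis by (simp add: tendsto_of_real_iff)
  qed
  have lim: "(\<lambda>t. measure (D t) I) \<longlonglongrightarrow> 1 / sqrt (2 * pi) * (LBINT x:I. exp (- (x\<^sup>2) / 2))"
    by (rule char_tendsto_std_normal_imp_interval[OF D char_lim assms(9)])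
  \<comment> \<open>At \<open>t = 0\<close> the scaled interval collapses to \<open>{0}\<close> or
    the empty set and the two probabilities can differ; agreement for positive \<open>t\<close>
    suffices for the limit.\<close>
  have "measure (D t) I = \<P>(\<omega> in M. real_of_int (fst (XT t \<omega>)) \<in> (\<lambda>x. sqrt (real t / \<mu>) * x) ` I)"
    if "t > 0" for t
  proof -
    have [measurable]: "I \<in> sets borel"
      using assms(9) by (rule real_interval_borel_measurable)
    have "\<sigma> t > 0" using that \<mu> by (simp add: \<sigma>_def)
    then have "x / \<sigma> t \<in> I \<longleftrightarrow> x \<in> (\<lambda>x. \<sigma> t * x) ` I" for x
      by (force simp: image_iff)
    then show ?thesis unfolding D_def
      by (subst measure_distr) (auto simp: \<sigma>_def intro!: arg_cong[where f = prob])
  qed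
  then have "eventually (\<lambda>t. measure (D t) I =
      \<P>(\<omega> in M. real_of_int (fst (XT t \<omega>)) \<in> (\<lambda>x. sqrt (real t / \<mu>) * x) ` I)) sequentially"
    by (auto simp: eventually_sequentially intro: exI[of _ 1])
  with lim have "(\<lambda>t. \<P>(\<omega> in M. real_of_int (fst (XT t \<omega>)) \<in> (\<lambda>x. sqrt (real t / \<mu>) * x) ` I))
      \<longlonglongrightarrow> 1 / sqrt (2 * pi) * (LBINT x:I. exp (- (x\<^sup>2) / 2))"
    by (rule Lim_transform_eventually)
  then show ?thesis by (intro tendsto_rabs_zero) (simp add: LIM_zero)
qed

end
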